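(* (1) Let $(A,\mu)$ be a Jordan-admissible algebra over $\mathbf{k}$ and $\alpha\colon A\to A$ be an algebra morphism. Then the induced Hom-algebra $A_\alpha=(A,\mu_\alpha=\alpha\circ\mu,\alpha)$ is a Hom-Jordan-admissible algebra. (2) Let $(A,\mu,\alpha)$ be a Hom-Jordan-admissible algebra over $\mathbf{k}$. Then the derived Hom-algebra $A^n=(A,\mu^{(n)}=\alpha^{2^n-1}\circ\mu,\alpha^{2^n})$ is also a Hom-Jordan-admissible algebra for each $n\ge 0$.
   Context: $\mathbf{k}$ is a fixed field of characteristic $0$; all modules, linear maps and tensor products are over $\mathbf{k}$. An algebra $(A,\mu)$ is a $\mathbf{k}$-module with a bilinear multiplication (not necessarily associative or unital); an algebra morphism is a linear map $\alpha$ with $\alpha(\mu(x,y))=\mu(\alpha(x),\alpha(y))$. A Jordan algebra is a commutative algebra satisfying $(x^2y)x=x^2(yx)$ for all $x,y$. An algebra $(A,\mu)$ is Jordan-admissible if $(A,\ast)$ is a Jordan algebra, where $x\ast y=\frac12(\mu(x,y)+\mu(y,x))$. A Hom-algebra is a triple $(A,\mu,\alpha)$ with $(A,\mu)$ an algebra and $\alpha\colon A\to A$ an algebra morphism of $(A,\mu)$. The Hom-associator is $as_A(x,y,z)=\mu(\mu(x,y),\alpha(z))-\mu(\alpha(x),\mu(y,z))$. A Hom-Jordan algebra is a Hom-algebra $(A,\mu,\alpha)$ with $\mu$ commutative and $as_A(\mu(x,x),\alpha(y),\alpha(x))=0$ for all $x,y\in A$. A Hom-algebra $(A,\mu,\alpha)$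 is Hom-Jordan-admissible if its plus Hom-algebra $A^+=(A,\ast,\alpha)$, with $x\ast y=\frac12(\mu(x,y)+\mu(y,x))$, is a Hom-Jordan algebra. Powers $\alpha^k$ denote $k$-fold composition, $\alpha^0=\mathrm{Id}$. *)

theory Defs
  imports Complex_Main
begin

text \<open>
  An algebra is a vector space over a field of characteristic 0, with carrier the whole type
  \<open>'a\<close> and scalar multiplication \<open>scale\<close>, together with a bilinear multiplication
  that need be neither associative nor unital.
\<close>

locale nonassoc_algebra = vector_space scale
  for scale :: "'k::field_char_0 \<Rightarrow> 'a::ab_group_add \<Rightarrow> 'a" +
  fixes mu :: "'a \<Rightarrow> 'a \<Rightarrow> 'a"
  assumes linear_mult_right: "Vector_Spaces.linear scale scale (\<lambda>y. mu x y)"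
    and linear_mult_left: "Vector_Spaces.linear scale scale (\<lambda>x. mu x y)"

definition algebra_morphism ::
    "('k::field_char_0 \<Rightarrow> 'a::ab_group_add \<Rightarrow> 'a) \<Rightarrow> ('a \<Rightarrow> 'a \<Rightarrow> 'a) \<Rightarrow> ('a \<Rightarrow> 'a) \<Rightarrow> bool" where
  "algebra_morphism scale mu \<alpha> \<longleftrightarrow>
     Vector_Spaces.linear scale scale \<alpha> \<and> (\<forall>x y. \<alpha> (mu x y) = mu (\<alpha> x) (\<alpha> y))"

locale jordan_algebra = nonassoc_algebra scale mu
  for scale :: "'k::field_char_0 \<Rightarrow> 'a::ab_group_add \<Rightarrow> 'a" and mu +
  assumes commute: "mu x y = mu y x"
    and jordan_identity: "mu (mu (mu x x) y) x = mu (mu x x) (mu y x)"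

definition plus_mult ::
    "('k::field_char_0 \<Rightarrow> 'a::ab_group_add \<Rightarrow> 'a) \<Rightarrow> ('a \<Rightarrow> 'a \<Rightarrow> 'a) \<Rightarrow> 'a \<Rightarrow> 'a \<Rightarrow> 'a" where
  "plus_mult scale mu x y = scale (1 / 2) (mu x y + mu y x)"

definition jordan_admissible ::
    "('k::field_char_0 \<Rightarrow> 'a::ab_group_add \<Rightarrow> 'a) \<Rightarrow> ('a \<Rightarrow> 'a \<Rightarrow> 'a) \<Rightarrow> bool" where
  "jordan_admissible scale mu \<longleftrightarrow>
     nonassoc_algebra scale mu \<and> jordan_algebra scale (plus_mult scale mu)"

locale hom_algebra = nonassoc_algebra scale mu
  for scale :: "'k::field_char_0 \<Rightarrow> 'a::ab_group_add \<Rightarrow> 'a" and mu +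
  fixes \<alpha> :: "'a \<Rightarrow> 'a"
  assumes morphism: "algebra_morphism scale mu \<alpha>"

definition hom_associator ::
    "('a::ab_group_add \<Rightarrow> 'a \<Rightarrow> 'a) \<Rightarrow> ('a \<Rightarrow> 'a) \<Rightarrow> 'a \<Rightarrow> 'a \<Rightarrow> 'a \<Rightarrow> 'a" where
  "hom_associator mu \<alpha> x y z = mu (mu x y) (\<alpha> z) - mu (\<alpha> x) (mu y z)"

locale hom_jordan_algebra = hom_algebra scale mu \<alpha>
  for scale :: "'k::field_char_0 \<Rightarrow> 'a::ab_group_add \<Rightarrow> 'a" and mu and \<alpha> +
  assumes commute: "mu x y = mu y x"
    and hom_jordan_identity: "hom_associator mu \<alpha> (mu x x) (\<alpha> y) (\<alpha> x) = 0"

definition hom_jordan_admissible ::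
    "('k::field_char_0 \<Rightarrow> 'a::ab_group_add \<Rightarrow> 'a) \<Rightarrow> ('a \<Rightarrow> 'a \<Rightarrow> 'a) \<Rightarrow> ('a \<Rightarrow> 'a) \<Rightarrow> bool" where
  "hom_jordan_admissible scale mu \<alpha> \<longleftrightarrow>
     hom_algebra scale mu \<alpha> \<and> hom_jordan_algebra scale (plus_mult scale mu) \<alpha>"

definition induced_mult :: "('a \<Rightarrow> 'a \<Rightarrow> 'a) \<Rightarrow> ('a \<Rightarrow> 'a) \<Rightarrow> 'a \<Rightarrow> 'a \<Rightarrow> 'a" where
  "induced_mult mu \<alpha> x y = \<alpha> (mu x y)"

definition derived_mult :: "('a \<Rightarrow> 'a \<Rightarrow> 'a) \<Rightarrow> ('a \<Rightarrow> 'a) \<Rightarrow> nat \<Rightarrow> 'a \<Rightarrow> 'a \<Rightarrow> 'a" where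
  "derived_mult mu \<alpha> n x y = (\<alpha> ^^ (2 ^ n - 1)) (mu x y)"

end

theory Submission
  imports Defs
begin

text \<open>
  Both parts are instances of one twisting principle. Let \<open>(A, \<mu>, \<alpha>)\<close> be a Hom-algebra and let
  \<open>\<beta>\<close> be a morphism of \<open>(A, \<mu>)\<close> that commutes with \<open>\<alpha>\<close>. Twisting by \<open>\<beta>\<close> gives the Hom-algebra
  \<open>(A, \<beta> \<circ> \<mu>, \<beta> \<circ> \<alpha>)\<close>. Its Hom-associator is \<open>\<beta>\<^sup>2\<close> applied to the old one, because the two
  multiplications in each term contribute one \<open>\<beta>\<close> each, and the \<open>\<beta>\<close> in the new twisting map balances
  the \<open>\<beta>\<close> of the inner product. In the Hom-Jordan identity all three arguments
  also carry a factor \<open>\<beta>\<close>, which can be pulled out because \<open>\<beta>\<close> commutes with \<open>\<alpha>\<close>. The new left-hand side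
  is therefore \<open>\<beta>\<^sup>3\<close> of the old one and still vanishes.

  Twisting commutes with passing to the plus algebra, since \<open>\<beta>\<close> is linear and is also a morphism
  of the plus product. So Hom-Jordan admissibility is preserved by twisting as well
  (\<open>hom_jordan_admissible_twist\<close>).

  A Jordan-admissible algebra is Hom-Jordan-admissible with twisting map the identity, and twisting
  it by \<open>\<alpha>\<close> gives the induced Hom-algebra. The derived Hom-algebra is the twist of \<open>(A, \<mu>, \<alpha>)\<close> by
  \<open>\<alpha>\<^bsup>k\<^esup>\<close> with \<open>k = 2\<^sup>n - 1\<close>, because \<open>\<alpha>\<^bsup>k\<^esup> \<circ> \<alpha> = \<alpha>\<^bsup>k + 1\<^esup>\<close>.
\<close>

lemma algebra_morphism_mult:
  "algebra_morphism scale mu \<beta> \<Longrightarrow> \<beta> (mu x y) = mu (\<beta> x) (\<beta> y)"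
  by (simp add: algebra_morphism_def)

lemma algebra_morphism_linear:
  "algebra_morphism scale mu \<beta> \<Longrightarrow> Vector_Spaces.linear scale scale \<beta>"
  by (simp add: algebra_morphism_def)

lemma algebra_morphism_id:
  assumes "vector_space scale"
  shows "algebra_morphism scale mu id"
  using vector_space.linear_id[OF assms] by (simp add: algebra_morphism_def)

lemma algebra_morphism_comp:
  assumes "algebra_morphism scale mu \<alpha>" "algebra_morphism scale mu \<beta>"
  shows "algebra_morphism scale mu (\<beta> \<circ> \<alpha>)"
  using assms Vector_Spaces.linear_compose[of scale scale \<alpha> scale \<beta>]
  by (simp add: algebra_morphism_def)

lemma algebra_morphism_funpow:
  assumes "vector_space scale" "algebra_morphism scale mu \<alpha>"
  shows "algebra_morphism scale mu (\<alpha> ^^ n)"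
proof (induction n)
  case 0
  show ?case using algebra_morphism_id[OF assms(1)] by (simp add: id_def)
next
  case (Suc n)
  show ?case using algebra_morphism_comp[OF Suc assms(2)] by (simp only: funpow.simps)
qed

lemma algebra_morphism_plus_mult:
  assumes "algebra_morphism scale mu \<beta>"
  shows "algebra_morphism scale (plus_mult scale mu) \<beta>"
proof -
  interpret Vector_Spaces.linear scale scale \<beta> using assms by (rule algebra_morphism_linear)
  show ?thesis
    using assms by (simp add: algebra_morphism_def plus_mult_def scale add)
qed

text \<open>
  Moving \<open>\<alpha>\<close> past \<open>\<beta>\<close> turns \<open>\<alpha> (\<beta> (mu x y))\<close> into \<open>\<beta> (\<alpha> (mu x y))\<close>, which is the twisted product of
  \<open>\<alpha> x\<close> and \<open>\<alpha> y\<close>.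
\<close>
lemma algebra_morphism_induced_mult:
  assumes \<alpha>: "algebra_morphism scale mu \<alpha>" and comm: "\<alpha> \<circ> \<beta> = \<beta> \<circ> \<alpha>"
  shows "algebra_morphism scale (induced_mult mu \<beta>) \<alpha>"
  using \<alpha> fun_cong[OF comm] by (simp add: algebra_morphism_def induced_mult_def)

lemma plus_mult_induced_mult:
  assumes "Vector_Spaces.linear scale scale \<beta>"
  shows "plus_mult scale (induced_mult mu \<beta>) = induced_mult (plus_mult scale mu) \<beta>"
proof -
  interpret Vector_Spaces.linear scale scale \<beta> by fact
  show ?thesis by (intro ext) (simp add: plus_mult_def induced_mult_def scale add)
qed

lemma nonassoc_algebra_induced_mult:
  assumes "nonassoc_algebra scale mu" and \<beta>: "Vector_Spaces.linear scale scale \<beta>"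
  shows "nonassoc_algebra scale (induced_mult mu \<beta>)"
proof -
  interpret nonassoc_algebra scale mu by fact
  show ?thesis
  \<comment> \<open>Stop at bilinearity: \<open>unfold_locales\<close> would split linearity into its axioms.\<close>
  proof (intro nonassoc_algebra.intro nonassoc_algebra_axioms.intro vector_space_axioms)
    show "Vector_Spaces.linear scale scale (\<lambda>y. induced_mult mu \<beta> x y)" for x
      using Vector_Spaces.linear_compose[OF linear_mult_right \<beta>] by (simp add: induced_mult_def o_def)
    show "Vector_Spaces.linear scale scale (\<lambda>x. induced_mult mu \<beta> x y)" for y
      using Vector_Spaces.linear_compose[OF linear_mult_left \<beta>] by (simp add: induced_mult_def o_def)
  qed
qed

lemma hom_algebra_twist:
  assumes "hom_algebra scale mu \<alpha>" and \<beta>: "algebra_morphism scale mu \<beta>"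
    and comm: "\<alpha> \<circ> \<beta> = \<beta> \<circ> \<alpha>"
  shows "hom_algebra scale (induced_mult mu \<beta>) (\<beta> \<circ> \<alpha>)"
proof -
  interpret hom_algebra scale mu \<alpha> by fact
  have "(\<beta> \<circ> \<alpha>) \<circ> \<beta> = \<beta> \<circ> (\<beta> \<circ> \<alpha>)"
    using comm by (simp add: o_assoc[symmetric])
  then have "algebra_morphism scale (induced_mult mu \<beta>) (\<beta> \<circ> \<alpha>)"
    using algebra_morphism_comp[OF morphism \<beta>] by (intro algebra_morphism_induced_mult)
  then show ?thesis
    using nonassoc_algebra_induced_mult[OF nonassoc_algebra_axioms algebra_morphism_linear[OF \<beta>]]
    by (simp add: hom_algebra_def hom_algebra_axioms_def)
qed

text \<open>
  In \<open>mu (mu x y) (\<alpha> z)\<close> the twisted inner product supplies a \<open>\<beta>\<close> to the first factor and the new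
  twisting map supplies one to the second, so this \<open>\<beta>\<close> can be pulled out and joined with that of the
  twisted outer product. The other term is symmetric.
\<close>
lemma hom_associator_induced_mult:
  assumes \<beta>: "algebra_morphism scale mu \<beta>"
  shows "hom_associator (induced_mult mu \<beta>) (\<beta> \<circ> \<alpha>) x y z = \<beta> (\<beta> (hom_associator mu \<alpha> x y z))"
proof -
  interpret Vector_Spaces.linear scale scale \<beta> using \<beta> by (rule algebra_morphism_linear)
  show ?thesis
    by (simp add: hom_associator_def induced_mult_def diff algebra_morphism_mult[OF \<beta>])
qed

lemma hom_associator_morphism:
  assumes \<beta>: "algebra_morphism scale mu \<beta>" and comm: "\<alpha> \<circ> \<beta> = \<beta> \<circ> \<alpha>"
  shows "hom_associator mu \<alpha> (\<beta> x) (\<beta> y) (\<beta> z) = \<beta> (hom_associator mu \<alpha> x y z)"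
proof -
  interpret Vector_Spaces.linear scale scale \<beta> using \<beta> by (rule algebra_morphism_linear)
  have "\<alpha> (\<beta> w) = \<beta> (\<alpha> w)" for w using fun_cong[OF comm, of w] by simp
  then show ?thesis
    by (simp add: hom_associator_def diff algebra_morphism_mult[OF \<beta>])
qed

lemma hom_jordan_algebra_twist:
  assumes "hom_jordan_algebra scale mu \<alpha>" and \<beta>: "algebra_morphism scale mu \<beta>"
    and comm: "\<alpha> \<circ> \<beta> = \<beta> \<circ> \<alpha>"
  shows "hom_jordan_algebra scale (induced_mult mu \<beta>) (\<beta> \<circ> \<alpha>)"
proof -
  interpret hom_jordan_algebra scale mu \<alpha> by fact
  interpret beta: Vector_Spaces.linear scale scale \<beta> using \<beta> by (rule algebra_morphism_linear)
  interpret twist: hom_algebra scale "induced_mult mu \<beta>" "\<beta> \<circ> \<alpha>"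
    using hom_algebra_axioms \<beta> comm by (rule hom_algebra_twist)
  show ?thesis
  proof
    show "induced_mult mu \<beta> x y = induced_mult mu \<beta> y x" for x y
      unfolding induced_mult_def by (subst commute) (rule refl)
  next
    fix x y
    have "hom_associator (induced_mult mu \<beta>) (\<beta> \<circ> \<alpha>)
            (induced_mult mu \<beta> x x) ((\<beta> \<circ> \<alpha>) y) ((\<beta> \<circ> \<alpha>) x)
          = \<beta> (\<beta> (hom_associator mu \<alpha> (\<beta> (mu x x)) (\<beta> (\<alpha> y)) (\<beta> (\<alpha> x))))"
      unfolding hom_associator_induced_mult[OF \<beta>] by (simp add: induced_mult_def)
    also have "\<dots> = \<beta> (\<beta> (\<beta> (hom_associator mu \<alpha> (mu x x) (\<alpha> y) (\<alpha> x))))"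
      unfolding hom_associator_morphism[OF \<beta> comm] ..
    also have "\<dots> = 0"
      by (simp add: hom_jordan_identity beta.zero)
    finally show "hom_associator (induced_mult mu \<beta>) (\<beta> \<circ> \<alpha>)
            (induced_mult mu \<beta> x x) ((\<beta> \<circ> \<alpha>) y) ((\<beta> \<circ> \<alpha>) x) = 0" .
  qed
qed

theorem hom_jordan_admissible_twist:
  assumes adm: "hom_jordan_admissible scale mu \<alpha>" and \<beta>: "algebra_morphism scale mu \<beta>"
    and comm: "\<alpha> \<circ> \<beta> = \<beta> \<circ> \<alpha>"
  shows "hom_jordan_admissible scale (induced_mult mu \<beta>) (\<beta> \<circ> \<alpha>)"
proof -
  have "hom_jordan_algebra scale (induced_mult (plus_mult scale mu) \<beta>) (\<beta> \<circ> \<alpha>)"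
    using adm algebra_morphism_plus_mult[OF \<beta>] comm
    unfolding hom_jordan_admissible_def by (blast intro: hom_jordan_algebra_twist)
  moreover have "hom_algebra scale (induced_mult mu \<beta>) (\<beta> \<circ> \<alpha>)"
    using adm \<beta> comm unfolding hom_jordan_admissible_def by (blast intro: hom_algebra_twist)
  ultimately show ?thesis
    unfolding hom_jordan_admissible_def plus_mult_induced_mult[OF algebra_morphism_linear[OF \<beta>]]
    by blast
qed

lemma hom_algebra_id:
  assumes "nonassoc_algebra scale mu"
  shows "hom_algebra scale mu id"
  using assms algebra_morphism_id[OF nonassoc_algebra.axioms(1)[OF assms]]
  by (simp add: hom_algebra_def hom_algebra_axioms_def)

text \<open>
  For \<open>\<alpha> = id\<close> the Hom-associator is the ordinary associator, and the Jordan identity says that the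
  associator of \<open>mu x x\<close>, \<open>y\<close>, \<open>x\<close> vanishes.
\<close>
lemma jordan_algebra_imp_hom_jordan_algebra_id:
  assumes "jordan_algebra scale mu"
  shows "hom_jordan_algebra scale mu id"
proof -
  interpret jordan_algebra scale mu by fact
  interpret hom_algebra scale mu id
    using nonassoc_algebra_axioms by (rule hom_algebra_id)
  show ?thesis
  proof
    show "mu x y = mu y x" for x y
      by (rule commute)
    show "hom_associator mu id (mu x x) (id y) (id x) = 0" for x y
      by (simp add: hom_associator_def jordan_identity)
  qed
qed

lemma jordan_admissible_imp_hom_jordan_admissible_id:
  "jordan_admissible scale mu \<Longrightarrow> hom_jordan_admissible scale mu id"
  unfolding jordan_admissible_def hom_jordan_admissible_def
  by (blast intro: hom_algebra_id jordan_algebra_imp_hom_jordan_algebra_id)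

theorem theorem5p9:
  fixes scale :: "'k::field_char_0 \<Rightarrow> 'a::ab_group_add \<Rightarrow> 'a"
  shows "(\<forall>mu \<alpha>. jordan_admissible scale mu \<longrightarrow> algebra_morphism scale mu \<alpha> \<longrightarrow>
            hom_jordan_admissible scale (induced_mult mu \<alpha>) \<alpha>) \<and>
         (\<forall>mu \<alpha>. hom_jordan_admissible scale mu \<alpha> \<longrightarrow>
            (\<forall>n::nat. hom_jordan_admissible scale (derived_mult mu \<alpha> n) (\<alpha> ^^ (2 ^ n))))"
proof (intro conjI allI impI)
  fix mu :: "'a \<Rightarrow> 'a \<Rightarrow> 'a" and \<alpha>
  assume "jordan_admissible scale mu" and \<alpha>: "algebra_morphism scale mu \<alpha>"
  then have "hom_jordan_admissible scale mu id"
    by (intro jordan_admissible_imp_hom_jordan_admissible_id)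
  from hom_jordan_admissible_twist[OF this \<alpha>]
  show "hom_jordan_admissible scale (induced_mult mu \<alpha>) \<alpha>" by simp
next
  fix mu :: "'a \<Rightarrow> 'a \<Rightarrow> 'a" and \<alpha> and n :: nat
  assume adm: "hom_jordan_admissible scale mu \<alpha>"
  then interpret hom_algebra scale mu \<alpha> by (simp add: hom_jordan_admissible_def)
  define k :: nat where "k = 2 ^ n - 1"
  have k: "2 ^ n = Suc k" by (simp add: k_def)
  have "hom_jordan_admissible scale (induced_mult mu (\<alpha> ^^ k)) (\<alpha> ^^ k \<circ> \<alpha>)"
  proof (rule hom_jordan_admissible_twist[OF adm])
    show "algebra_morphism scale mu (\<alpha> ^^ k)"
      using vector_space_axioms morphism by (rule algebra_morphism_funpow)
    show "\<alpha> \<circ> \<alpha> ^^ k = \<alpha> ^^ k \<circ> \<alpha>"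
      by (metis funpow.simps(2) funpow_Suc_right)
  qed
  moreover have "induced_mult mu (\<alpha> ^^ k) = derived_mult mu \<alpha> n"
    by (intro ext) (simp add: induced_mult_def derived_mult_def k_def)
  moreover have "\<alpha> ^^ k \<circ> \<alpha> = \<alpha> ^^ (2 ^ n)"
    unfolding k funpow_Suc_right ..
  ultimately show "hom_jordan_admissible scale (derived_mult mu \<alpha> n) (\<alpha> ^^ (2 ^ n))"
    by simp
qed

end
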